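(* Let $d\in\mathbb{N}$, let $\theta>d/2$, and let $\Phi$ be the Matérn kernel on $\mathbb{R}^d$ with smoothness parameter $\theta$. Then there is a constant $C=C(\Phi,d)>0$, and for every $\eta>1$ and every $c_{\mathrm{qu}}>0$ there is a constant $\widetilde C=\widetilde C(\Phi,d,\eta,c_{\mathrm{qu}})>0$, such that the following holds. Let $\Omega\subseteq\mathbb{R}^d$ be a bounded domain and let $X=\{\boldsymbol{x}_1,\dots,\boldsymbol{x}_N\}\subseteq\Omega$ be a quasi-uniform set of data sites with quasi-uniformity constant $c_{\mathrm{qu}}$, fill-distance $h_{X,\Omega}$ and separation radius $q_X$. Let $\delta=\eta h_{X,\Omega}$, let $\Phi_\delta=\delta^{-d}\Phi(\cdot/\delta)$ be the rescaled kernel, and let $\boldsymbol{K}=[\Phi_\delta(\boldsymbol{x}_i-\boldsymbol{x}_j)]_{i,j=1}^N$. Then the smallest eigenvalue of $\boldsymbol{K}$ satisfies $$\lambda_{\min}(\boldsymbol{K})\ \geq\ C\,(\eta c_{\mathrm{qu}})^{d-2\theta}\,\delta^{-d},$$ and the largest eigenvalue of $\boldsymbol{K}$ satisfies $$\lambda_{\max}(\boldsymbol{K})\ \leq\ \widetilde C\,\delta^{-d}.$$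
   Context: For a finite set $X=\{\boldsymbol{x}_1,\dots,\boldsymbol{x}_N\}$ of pairwise distinct points in $\Omega\subseteq\mathbb{R}^d$, the fill-distance is $h_{X,\Omega}=\sup_{\boldsymbol{x}\in\Omega}\min_{\boldsymbol{x}_j\in X}\|\boldsymbol{x}-\boldsymbol{x}_j\|_2$ and the separation radius is $q_X=\frac12\min_{j\neq k}\|\boldsymbol{x}_j-\boldsymbol{x}_k\|_2$. The set $X$ is quasi-uniform with constant $c_{\mathrm{qu}}>0$ if $q_X\leq h_{X,\Omega}\leq c_{\mathrm{qu}}\,q_X$. The Matérn kernel with smoothness parameter $\theta>d/2$ is $\Phi(\boldsymbol{x})=\phi_\theta(\|\boldsymbol{x}\|_2)$, $\boldsymbol{x}\in\mathbb{R}^d$, with $$\phi_\theta(r)=\frac{2^{1-\theta+d/2}}{\Gamma(\theta-d/2)}\,r^{\theta-d/2}K_{\theta-d/2}(r),\qquad r\geq 0$$ (extended continuously to $r=0$), where $\Gamma$ is the Gamma function and $K_\nu$ is the modified Bessel function of the second kind of order $\nu$. Up to normalization, its Fourier transform is $(1+\|\boldsymbol{\omega}\|_2^2)^{-\theta}$. *)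

theory Defs
  imports "HOL-Analysis.Analysis" "Jordan_Normal_Form.Spectral_Radius"
begin

section \<open>Geometry of the data sites\<close>

definition fill_distance :: "'a::metric_space set \<Rightarrow> 'a set \<Rightarrow> real" where
  "fill_distance X \<Omega> = (SUP x\<in>\<Omega>. Min (dist x ` X))"

text \<open>Only meaningful for finite sets of at least two points.\<close>

definition separation_radius :: "'a::metric_space set \<Rightarrow> real" where
  "separation_radius X = 1 / 2 * Min {dist x y | x y. x \<in> X \<and> y \<in> X \<and> x \<noteq> y}"

definition quasi_uniform :: "real \<Rightarrow> 'a::metric_space set \<Rightarrow> 'a set \<Rightarrow> bool" where
  "quasi_uniform c X \<Omega> \<longleftrightarrow>
     separation_radius X \<le> fill_distance X \<Omega> \<and>
     fill_distance X \<Omega> \<le> c * separation_radius X"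

section \<open>The Matern kernel\<close>

text \<open>
  Modified Bessel function of the second kind, given for real order \<open>\<nu>\<close> and \<open>r > 0\<close> by
  \<open>K\<^sub>\<nu>(r) = \<integral>\<^sub>0\<^sup>\<infinity> exp (-r cosh t) cosh (\<nu> t) dt\<close>.  This is the defining formula in
  Wendland, Scattered Data Approximation, Definition 5.10.
\<close>

definition bessel_K :: "real \<Rightarrow> real \<Rightarrow> real" where
  "bessel_K \<nu> r = (LINT t:{0..}|lborel. exp (- r * cosh t) * cosh (\<nu> * t))"

definition matern_phi_pos :: "nat \<Rightarrow> real \<Rightarrow> real \<Rightarrow> real" where
  "matern_phi_pos d \<theta> r =
     2 powr (1 - \<theta> + real d / 2) / Gamma (\<theta> - real d / 2) *
     r powr (\<theta> - real d / 2) * bessel_K (\<theta> - real d / 2) r"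

text \<open>The formula is used for \<open>r > 0\<close> and continuously extended to \<open>r = 0\<close>.\<close>

definition matern_phi :: "nat \<Rightarrow> real \<Rightarrow> real \<Rightarrow> real" where
  "matern_phi d \<theta> r =
     (if r = 0 then Lim (at_right 0) (matern_phi_pos d \<theta>) else matern_phi_pos d \<theta> r)"

definition matern_kernel :: "real \<Rightarrow> real ^ 'n \<Rightarrow> real" where
  "matern_kernel \<theta> x = matern_phi CARD('n) \<theta> (norm x)"

definition rescaled_kernel :: "real \<Rightarrow> (real ^ 'n \<Rightarrow> real) \<Rightarrow> real ^ 'n \<Rightarrow> real" where
  "rescaled_kernel \<delta> \<Phi> x = \<Phi> (x /\<^sub>R \<delta>) / \<delta> ^ CARD('n)"

section \<open>Kernel matrices and their extreme eigenvalues\<close>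

definition kernel_matrix ::
  "('a::minus \<Rightarrow> real) \<Rightarrow> nat \<Rightarrow> (nat \<Rightarrow> 'a) \<Rightarrow> real Matrix.mat" where
  "kernel_matrix k N x = Matrix.mat N N (\<lambda>(i, j). k (x i - x j))"

text \<open>
  The spectrum here is the set of real eigenvalues.  The definitions below are meant for
  symmetric real matrices of positive size, which have no others and at least one of these.
\<close>

definition lambda_min :: "real Matrix.mat \<Rightarrow> real" where
  "lambda_min A = Min (spectrum A)"

definition lambda_max :: "real Matrix.mat \<Rightarrow> real" where
  "lambda_max A = Max (spectrum A)"

end

theory Submission
  imports Defs
begin

text \<open>
  No Fourier transform is needed: translating the integration variable by \<open>ln r\<close> in the integral
  for the Bessel function exhibits the Matern function as a mixture over \<open>t\<close> of the Gaussians
  \<open>exp (- exp (- t) r\<^sup>2 / 2)\<close> with weight \<open>exp (\<nu> t - exp t / 2)\<close>, where \<open>\<nu> = \<theta> - d / 2\<close>.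
  After rescaling by \<open>\<delta>\<close> the sites are separated by \<open>s = 2 / (\<eta> c\<^sub>q\<^sub>u)\<close>.  Every Gaussian
  matrix is positive semidefinite, and those with \<open>exp t\<close> below a small multiple of \<open>s\<^sup>2\<close> are
  diagonally dominant; a unit interval of such \<open>t\<close> already contributes a multiple of
  \<open>s\<close> to the power \<open>2 \<nu>\<close> to the quadratic form, which is the lower bound.  The upper bound is
  Gershgorin's, since the kernel decays exponentially and separated points cannot cluster.
\<close>

section \<open>Packing of separated points\<close>

text \<open>Volume comparison: the balls of radius \<open>s / 2\<close> about the points are
  disjoint and all lie in the ball of radius \<open>R + s / 2\<close> about
  \<open>a\<close>.\<close>

lemma card_separated_le:
  fixes x :: "'i \<Rightarrow> 'a::euclidean_space"
  assumes fin: "finite I" and s: "0 < s" and R: "0 \<le> R"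
    and sep: "pairwise (\<lambda>i j. s \<le> dist (x i) (x j)) I"
    and sub: "\<And>i. i \<in> I \<Longrightarrow> dist a (x i) \<le> R"
  shows "real (card I) \<le> (2 * R / s + 1) ^ DIM('a)"
proof -
  let ?B = "\<lambda>i. ball (x i) (s / 2)" and ?V = "unit_ball_vol (real DIM('a))"
  have disj: "pairwise (\<lambda>i j. disjnt (?B i) (?B j)) I"
    unfolding pairwise_def
  proof (intro ballI impI)
    fix i j assume "i \<in> I" "j \<in> I" "i \<noteq> j"
    then have "s \<le> dist (x i) (x j)" using sep by (auto simp: pairwise_def)
    then show "disjnt (?B i) (?B j)"
      unfolding disjnt_def by (intro disjoint_ballI) simp
  qed
  have "(\<Sum>i\<in>I. measure lborel (?B i)) = measure lborel (\<Union>i\<in>I. ?B i)"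
    using fin disj fmeasurableI2[OF fmeasurable_compact[OF compact_cball] ball_subset_cball]
    by (intro measure_UNION'[symmetric]) auto
  also have "\<dots> \<le> measure lborel (ball a (R + s / 2))"
  proof (rule measure_mono_fmeasurable)
    show "(\<Union>i\<in>I. ?B i) \<subseteq> ball a (R + s / 2)"
    proof clarify
      fix i y assume i: "i \<in> I" and y: "y \<in> ?B i"
      have "dist a y \<le> dist a (x i) + dist (x i) y" by (rule dist_triangle)
      then show "y \<in> ball a (R + s / 2)" using sub[OF i] y by simp
    qed
  qed (auto intro: borel_open fmeasurableI2[OF fmeasurable_compact[OF compact_cball] ball_subset_cball])
  finally have "real (card I) * (?V * (s / 2) ^ DIM('a)) \<le> ?V * (R + s / 2) ^ DIM('a)"
    using s R by (simp add: content_ball)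
  then have "?V * (real (card I) * (s / 2) ^ DIM('a)) \<le> ?V * (R + s / 2) ^ DIM('a)"
    by (simp add: ac_simps)
  then have "real (card I) * (s / 2) ^ DIM('a) \<le> (R + s / 2) ^ DIM('a)"
    using unit_ball_vol_pos[of "real DIM('a)"] by (simp add: mult_le_cancel_left_pos)
  then have "real (card I) \<le> (R + s / 2) ^ DIM('a) / (s / 2) ^ DIM('a)"
    using s by (simp add: pos_le_divide_eq)
  also have "\<dots> = ((R + s / 2) / (s / 2)) ^ DIM('a)"
    by (rule power_divide[symmetric])
  also have "(R + s / 2) / (s / 2) = 2 * R / s + 1"
    using s by (simp add: field_simps)
  finally show ?thesis .
qed

text \<open>Lets a polynomial packing count be paid for with half of an exponential decay. For
  \<open>n > 0\<close> and \<open>y = x / (2 * real n)\<close>, both \<open>y\<close> and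
  \<open>1\<close> are at most \<open>exp y\<close>, and the \<open>n\<close>-th power of
  \<open>exp y\<close> is \<open>exp (x / 2)\<close>.\<close>

lemma power_affine_le_exp:
  fixes a b :: real
  assumes a: "0 \<le> a" and b: "0 \<le> b"
  shows "\<exists>C\<ge>0. \<forall>x\<ge>0. (a * x + b) ^ n \<le> C * exp (x / 2)"
proof (intro exI[of _ "((a * (2 * real n) + b)) ^ n"] conjI allI impI)
  show "0 \<le> (a * (2 * real n) + b) ^ n" using a b by simp
  fix x :: real assume x: "0 \<le> x"
  show "(a * x + b) ^ n \<le> (a * (2 * real n) + b) ^ n * exp (x / 2)"
  proof (cases "n = 0")
    case False
    define y where "y = x / (2 * real n)"
    have y: "0 \<le> y" using x by (simp add: y_def)
    have e: "1 + y \<le> exp y" by (rule exp_ge_add_one_self)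
    have x_eq: "x = (2 * real n) * y" using False by (simp add: y_def)
    have "a * x + b \<le> a * (2 * real n) * exp y + b * exp y"
    proof (rule add_mono)
      have "y \<le> exp y" using e by linarith
      then show "a * x \<le> a * (2 * real n) * exp y"
        unfolding x_eq using a by (simp add: mult.assoc mult_left_mono)
      show "b \<le> b * exp y" using b y mult_left_mono[of 1 "exp y" b] by simp
    qed
    also have "\<dots> = (a * (2 * real n) + b) * exp y" by (simp add: algebra_simps)
    finally have "(a * x + b) ^ n \<le> ((a * (2 * real n) + b) * exp y) ^ n"
      using a b x by (intro power_mono) auto
    also have "\<dots> = (a * (2 * real n) + b) ^ n * exp (x / 2)"
      using False by (simp add: y_def power_mult_distrib flip: exp_of_nat_mult)
    finally show ?thesis .
  qed (use x in simp)
qed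

text \<open>The points are sorted into unit shells about \<open>a\<close>: the number in shell
  \<open>n\<close> grows polynomially in \<open>n\<close>, while each term there is at most
  \<open>exp (- n)\<close>. The bound \<open>S\<close> depends only on \<open>s\<close> and the
  dimension, so it is uniform in the number of points and in the centre.\<close>

lemma separated_exp_sum_bounded:
  assumes s: "0 < s"
  shows "\<exists>S>0. \<forall>(I :: nat set) (x :: nat \<Rightarrow> 'a::euclidean_space) a.
    finite I \<and> pairwise (\<lambda>i j. s \<le> dist (x i) (x j)) I \<longrightarrow> (\<Sum>i\<in>I. exp (- dist a (x i))) \<le> S"
proof -
  obtain C where C: "C \<ge> 0" "\<And>x. x \<ge> 0 \<Longrightarrow> (2 / s * x + (2 / s + 1)) ^ DIM('a) \<le> C * exp (x / 2)"
    using power_affine_le_exp[of "2 / s" "2 / s + 1" "DIM('a)"] s by auto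
  \<comment> \<open>The packing count uses up \<open>exp (n / 2)\<close> of the decay
    \<open>exp (- n)\<close>; a geometric sequence with this ratio remains.\<close>
  define q :: real where "q = exp (- (1 / 2))"
  have q: "0 < q" "q < 1" by (auto simp: q_def)
  have sm: "summable (\<lambda>n. C * q ^ n)" using q by (intro summable_mult summable_geometric) auto
  \<comment> \<open>The summand \<open>1\<close> makes the bound strictly positive even when
    \<open>C\<close> is zero.\<close>
  show ?thesis
  proof (intro exI[of _ "(\<Sum>n. C * q ^ n) + 1"] conjI allI impI)
    have "0 \<le> (\<Sum>n. C * q ^ n)" using sm C q by (intro suminf_nonneg) auto
    then show "0 < (\<Sum>n. C * q ^ n) + 1" by simp
    fix I :: "nat set" and x :: "nat \<Rightarrow> 'a" and a
    assume "finite I \<and> pairwise (\<lambda>i j. s \<le> dist (x i) (x j)) I"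
    then have fin: "finite I" and sep: "pairwise (\<lambda>i j. s \<le> dist (x i) (x j)) I" by auto
    define g where "g i = nat \<lfloor>dist a (x i)\<rfloor>" for i
    have g: "real (g i) \<le> dist a (x i)" "dist a (x i) \<le> real (g i) + 1" for i
      unfolding g_def by auto
    have "(\<Sum>i\<in>I. exp (- dist a (x i))) = (\<Sum>n\<in>g ` I. \<Sum>i\<in>{i\<in>I. g i = n}. exp (- dist a (x i)))"
      by (rule sum.image_gen[OF fin])
    also have "\<dots> \<le> (\<Sum>n\<in>g ` I. C * q ^ n)"
    proof (rule sum_mono)
      fix n assume "n \<in> g ` I"
      let ?J = "{i\<in>I. g i = n}"
      have "(\<Sum>i\<in>?J. exp (- dist a (x i))) \<le> (\<Sum>i\<in>?J. exp (- real n))"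
        using g(1) by (intro sum_mono) auto
      also have "\<dots> = real (card ?J) * exp (- real n)" by simp
      \<comment> \<open>Since \<open>g\<close> rounds distances down, shell \<open>n\<close> lies
        within distance \<open>n + 1\<close> of \<open>a\<close>.\<close>
      also have "real (card ?J) \<le> (2 * (real n + 1) / s + 1) ^ DIM('a)"
      proof (rule card_separated_le[OF _ s])
        show "finite ?J" using fin by simp
        show "pairwise (\<lambda>i j. s \<le> dist (x i) (x j)) ?J"
          using sep by (rule pairwise_subset) auto
        show "dist a (x i) \<le> real n + 1" if "i \<in> ?J" for i using g(2)[of i] that by auto
      qed simp
      also have "2 * (real n + 1) / s + 1 = 2 / s * real n + (2 / s + 1)"
        using s by (simp add: field_simps)
      also have "(2 / s * real n + (2 / s + 1)) ^ DIM('a) \<le> C * exp (real n / 2)"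
        by (rule C) simp
      also have "C * exp (real n / 2) * exp (- real n) = C * q ^ n"
        by (simp add: q_def mult.assoc flip: exp_add exp_of_nat_mult)
      finally show "(\<Sum>i\<in>?J. exp (- dist a (x i))) \<le> C * q ^ n" by simp
    qed
    also have "\<dots> \<le> (\<Sum>n. C * q ^ n)"
      using sm C q fin by (intro sum_le_suminf) auto
    finally show "(\<Sum>i\<in>I. exp (- dist a (x i))) \<le> (\<Sum>n. C * q ^ n) + 1" by simp
  qed
qed

section \<open>Quadratic forms and spectra\<close>

lemma sum_delta_prod:
  fixes c :: "'i \<Rightarrow> real"
  assumes "finite I"
  shows "(\<Sum>i\<in>I. \<Sum>j\<in>I. c i * c j * (if i = j then b else 0)) = b * (\<Sum>i\<in>I. (c i)\<^sup>2)"
  using assms by (simp add: if_distrib[where f = "\<lambda>z. _ * z"] sum.delta power2_eq_square sum_distrib_left ac_simps cong: if_cong)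

text \<open>Gershgorin's estimate for quadratic forms: \<open>\<bar>c i * c j\<bar>\<close> is at
  most the mean of the two squares, and by symmetry both squares meet the same row sums. It serves
  for the off-diagonal part of a Gaussian matrix and for the whole Matern matrix.\<close>

lemma abs_quadratic_form_le:
  fixes k :: "'i \<Rightarrow> 'i \<Rightarrow> real"
  assumes fin: "finite I" and sym: "\<And>i j. i \<in> I \<Longrightarrow> j \<in> I \<Longrightarrow> k i j = k j i"
    and row: "\<And>i. i \<in> I \<Longrightarrow> (\<Sum>j\<in>I. \<bar>k i j\<bar>) \<le> b"
  shows "\<bar>\<Sum>i\<in>I. \<Sum>j\<in>I. c i * c j * k i j\<bar> \<le> b * (\<Sum>i\<in>I. (c i)\<^sup>2)"
proof -
  let ?s = "\<lambda>f. \<Sum>i\<in>I. \<Sum>j\<in>I. f i j * \<bar>k i j\<bar>"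
  have swap: "?s (\<lambda>i j. (c j)\<^sup>2) = ?s (\<lambda>i j. (c i)\<^sup>2)"
    by (subst sum.swap) (intro sum.cong refl, simp add: sym)
  have "\<bar>\<Sum>i\<in>I. \<Sum>j\<in>I. c i * c j * k i j\<bar> \<le> (\<Sum>i\<in>I. \<Sum>j\<in>I. \<bar>c i * c j * k i j\<bar>)"
    by (intro order_trans[OF sum_abs] sum_mono sum_abs)
  also have "\<dots> \<le> ?s (\<lambda>i j. ((c i)\<^sup>2 + (c j)\<^sup>2) / 2)"
  proof (intro sum_mono)
    fix i j
    have "\<bar>c i * c j\<bar> \<le> ((c i)\<^sup>2 + (c j)\<^sup>2) / 2"
      using sum_squares_bound[of "\<bar>c i\<bar>" "\<bar>c j\<bar>"] by (simp add: abs_mult)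
    then show "\<bar>c i * c j * k i j\<bar> \<le> ((c i)\<^sup>2 + (c j)\<^sup>2) / 2 * \<bar>k i j\<bar>"
      unfolding abs_mult[of _ "k i j"] by (rule mult_right_mono) simp
  qed
  also have "\<dots> = (?s (\<lambda>i j. (c i)\<^sup>2) + ?s (\<lambda>i j. (c j)\<^sup>2)) / 2"
    by (simp add: add_divide_distrib distrib_right sum.distrib sum_divide_distrib)
  also have "\<dots> = (\<Sum>i\<in>I. (c i)\<^sup>2 * (\<Sum>j\<in>I. \<bar>k i j\<bar>))"
    unfolding swap by (simp flip: sum_distrib_left)
  also have "\<dots> \<le> (\<Sum>i\<in>I. (c i)\<^sup>2 * b)"
    by (intro sum_mono mult_left_mono row) auto
  finally show ?thesis by (simp add: sum_distrib_left ac_simps)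
qed

section \<open>Positive semidefiniteness of Gaussian matrices\<close>

text \<open>Expanding one inner product in coordinates splits the form into one form per basis
  vector \<open>b\<close>, with the next lower power and coefficients
  \<open>c i * inner (x i) b\<close>. The induction therefore ranges over all
  \<open>c\<close>.\<close>

lemma power_inner_nonneg_definite:
  fixes x :: "'i \<Rightarrow> 'a::euclidean_space"
  shows "0 \<le> (\<Sum>i\<in>I. \<Sum>j\<in>I. c i * c j * (inner (x i) (x j)) ^ n)"
proof (induction n arbitrary: c)
  case 0
  have "(\<Sum>i\<in>I. \<Sum>j\<in>I. c i * c j) = (\<Sum>i\<in>I. c i)\<^sup>2"
    by (simp add: power2_eq_square sum_product)
  then show ?case by simp
next
  case (Suc n)
  have "(\<Sum>i\<in>I. \<Sum>j\<in>I. c i * c j * inner (x i) (x j) ^ Suc n) =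
    (\<Sum>i\<in>I. \<Sum>j\<in>I. \<Sum>b\<in>Basis. (c i * inner (x i) b) * (c j * inner (x j) b) * inner (x i) (x j) ^ n)"
  proof (intro sum.cong refl)
    fix i j
    have "(\<Sum>b\<in>Basis. (c i * inner (x i) b) * (c j * inner (x j) b) * inner (x i) (x j) ^ n) =
      (c i * c j * inner (x i) (x j) ^ n) * (\<Sum>b\<in>Basis. inner (x i) b * inner (x j) b)"
      by (simp add: sum_distrib_left ac_simps)
    then show "c i * c j * inner (x i) (x j) ^ Suc n =
      (\<Sum>b\<in>Basis. (c i * inner (x i) b) * (c j * inner (x j) b) * inner (x i) (x j) ^ n)"
      by (simp add: ac_simps flip: euclidean_inner)
  qed
  also have "\<dots> = (\<Sum>b\<in>Basis. \<Sum>i\<in>I. \<Sum>j\<in>I. (c i * inner (x i) b) * (c j * inner (x j) b) * inner (x i) (x j) ^ n)"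
    by (subst (2) sum.swap, subst sum.swap) (rule refl)
  also have "\<dots> \<ge> 0" by (intro sum_nonneg Suc.IH)
  finally show ?case .
qed

text \<open>The exponential series has nonnegative coefficients, so the form is a convergent sum of
  nonnegative forms.\<close>

lemma exp_inner_nonneg_definite:
  fixes x :: "'i \<Rightarrow> 'a::euclidean_space"
  assumes a: "0 \<le> a"
  shows "0 \<le> (\<Sum>i\<in>I. \<Sum>j\<in>I. c i * c j * exp (a * inner (x i) (x j)))"
proof (rule sums_le)
  show "(\<lambda>_. 0 :: real) sums 0" by simp
  show "(\<lambda>n. \<Sum>i\<in>I. \<Sum>j\<in>I. c i * c j * ((a * inner (x i) (x j)) ^ n /\<^sub>R fact n)) sums
      (\<Sum>i\<in>I. \<Sum>j\<in>I. c i * c j * exp (a * inner (x i) (x j)))"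
    by (intro sums_sum sums_mult exp_converges)
  fix n
  have "(\<Sum>i\<in>I. \<Sum>j\<in>I. c i * c j * ((a * inner (x i) (x j)) ^ n /\<^sub>R fact n)) =
    a ^ n / fact n * (\<Sum>i\<in>I. \<Sum>j\<in>I. c i * c j * (inner (x i) (x j)) ^ n)"
    by (simp add: sum_distrib_left power_mult_distrib divide_inverse ac_simps)
  then show "0 \<le> (\<Sum>i\<in>I. \<Sum>j\<in>I. c i * c j * ((a * inner (x i) (x j)) ^ n /\<^sub>R fact n))"
    using a by (simp add: power_inner_nonneg_definite)
qed

text \<open>Expanding the squared distance leaves an exponential of the inner product and two
  factors depending on one point each; these are absorbed into the coefficients.\<close>

lemma gaussian_nonneg_definite:
  fixes x :: "'i \<Rightarrow> 'a::euclidean_space"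
  assumes a: "0 \<le> a"
  shows "0 \<le> (\<Sum>i\<in>I. \<Sum>j\<in>I. c i * c j * exp (- (a * (dist (x i) (x j))\<^sup>2)))"
proof -
  have "exp (- (a * (dist (x i) (x j))\<^sup>2)) =
    exp (- (a * (norm (x i))\<^sup>2)) * exp (- (a * (norm (x j))\<^sup>2)) * exp ((2 * a) * inner (x i) (x j))" for i j
    by (simp add: dist_norm power2_norm_eq_inner inner_diff inner_commute algebra_simps flip: exp_add)
  then have "(\<Sum>i\<in>I. \<Sum>j\<in>I. c i * c j * exp (- (a * (dist (x i) (x j))\<^sup>2))) =
    (\<Sum>i\<in>I. \<Sum>j\<in>I. (c i * exp (- (a * (norm (x i))\<^sup>2))) * (c j * exp (- (a * (norm (x j))\<^sup>2))) *
      exp ((2 * a) * inner (x i) (x j)))"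
    by (simp add: ac_simps)
  also have "\<dots> \<ge> 0" using a by (intro exp_inner_nonneg_definite) simp
  finally show ?thesis .
qed

section \<open>Spectra of real symmetric matrices\<close>

text \<open>Ensures that \<open>Min\<close> and \<open>Max\<close> of the real spectrum are
  meaningful. The same matrix over the complex numbers has an eigenvalue; symmetry makes it real,
  and then the real or the imaginary part of the eigenvector is a real eigenvector.\<close>

lemma symmetric_mat_spectrum_nonempty:
  fixes k :: "nat \<Rightarrow> nat \<Rightarrow> real"
  assumes N: "0 < N" and sym: "\<And>i j. i < N \<Longrightarrow> j < N \<Longrightarrow> k i j = k j i"
  shows "spectrum (Matrix.mat N N (\<lambda>(i, j). k i j)) \<noteq> {}"
proof -
  define A where "A = Matrix.mat N N (\<lambda>(i, j). k i j)"
  define B where "B = Matrix.mat N N (\<lambda>(i, j). complex_of_real (k i j))"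
  have "spectrum B \<noteq> {}" using N by (intro spectrum_non_empty[of _ N]) (auto simp: B_def)
  then obtain v \<mu> where v: "v \<in> carrier_vec N" "v \<noteq> 0\<^sub>v N" "B *\<^sub>v v = \<mu> \<cdot>\<^sub>v v"
    by (auto simp: spectrum_def eigenvalue_def eigenvector_def B_def)
  define a where "a i = Re (vec_index v i)" for i
  define b where "b i = Im (vec_index v i)" for i
  have eq: "(\<Sum>j<N. complex_of_real (k i j) * vec_index v j) = \<mu> * vec_index v i" if "i < N" for i
    using arg_cong[OF v(3), of "\<lambda>w. vec_index w i"] that v(1)
    by (simp add: B_def scalar_prod_def atLeast0LessThan)
  have ea: "(\<Sum>j<N. k i j * a j) = Re \<mu> * a i - Im \<mu> * b i" if "i < N" for i
    using arg_cong[OF eq[OF that], of Re] by (simp add: a_def b_def)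
  have eb: "(\<Sum>j<N. k i j * b j) = Re \<mu> * b i + Im \<mu> * a i" if "i < N" for i
    using arg_cong[OF eq[OF that], of Im] by (simp add: a_def b_def)
  have "\<exists>i<N. vec_index v i \<noteq> 0"
    using v(1,2) by (metis carrier_vecD eq_vecI index_zero_vec)
  then obtain i0 where i0: "i0 < N" "a i0 \<noteq> 0 \<or> b i0 \<noteq> 0"
    by (auto simp: a_def b_def complex_eq_iff)
  \<comment> \<open>By symmetry, pairing the image of \<open>a\<close> with \<open>b\<close> equals
    pairing the image of \<open>b\<close> with \<open>a\<close>. The terms with
    \<open>Re \<mu>\<close> cancel, leaving \<open>Im \<mu>\<close> times a positive sum of
    squares.\<close>
  have "(\<Sum>i<N. b i * (\<Sum>j<N. k i j * a j)) = (\<Sum>i<N. \<Sum>j<N. b i * k i j * a j)"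
    by (simp add: sum_distrib_left ac_simps)
  also have "\<dots> = (\<Sum>j<N. \<Sum>i<N. b i * k i j * a j)"
    by (rule sum.swap)
  also have "\<dots> = (\<Sum>i<N. a i * (\<Sum>j<N. k i j * b j))"
    by (auto simp: sum_distrib_left sym intro!: sum.cong)
  finally have "(\<Sum>i<N. b i * (Re \<mu> * a i - Im \<mu> * b i)) = (\<Sum>i<N. a i * (Re \<mu> * b i + Im \<mu> * a i))"
    by (simp add: ea eb)
  then have "Im \<mu> * (\<Sum>i<N. (a i)\<^sup>2 + (b i)\<^sup>2) = 0"
    by (simp add: algebra_simps sum.distrib sum_subtractf sum_distrib_left power2_eq_square)
  moreover have "0 < (\<Sum>i<N. (a i)\<^sup>2 + (b i)\<^sup>2)"
    using i0 by (intro sum_pos2[of _ i0]) (auto simp: add_pos_nonneg add_nonneg_pos)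
  ultimately have im: "Im \<mu> = 0" by auto
  \<comment> \<open>Stated for a general \<open>f\<close> so that it applies to whichever of
    \<open>a\<close> and \<open>b\<close> is nonzero at \<open>i0\<close>.\<close>
  have *: "Re \<mu> \<in> spectrum A"
    if f: "\<And>i. i < N \<Longrightarrow> (\<Sum>j<N. k i j * f j) = Re \<mu> * f i" and nz: "f i0 \<noteq> 0" for f
  proof -
    have "Matrix.vec N f \<noteq> 0\<^sub>v N" using nz i0(1) by (metis index_vec index_zero_vec(1))
    moreover have "A *\<^sub>v Matrix.vec N f = Re \<mu> \<cdot>\<^sub>v Matrix.vec N f"
      by (rule eq_vecI) (auto simp: A_def scalar_prod_def atLeast0LessThan f)
    ultimately have "eigenvector A (Matrix.vec N f) (Re \<mu>)"
      by (simp add: eigenvector_def A_def)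
    then show ?thesis by (auto simp: spectrum_def eigenvalue_def)
  qed
  from i0(2) have "Re \<mu> \<in> spectrum A"
    using *[of a] *[of b] ea eb im by auto
  then show ?thesis by (auto simp: A_def)
qed

text \<open>At an eigenvector the quadratic form equals the eigenvalue times the sum of squares, so
  both bounds pass to every real eigenvalue, and from there to the extremes of a finite nonempty
  set.\<close>

lemma symmetric_mat_spectrum_bounds:
  fixes k :: "nat \<Rightarrow> nat \<Rightarrow> real"
  assumes N: "0 < N" and sym: "\<And>i j. i < N \<Longrightarrow> j < N \<Longrightarrow> k i j = k j i"
    and lower: "\<And>c. l * (\<Sum>i<N. (c i)\<^sup>2) \<le> (\<Sum>i<N. \<Sum>j<N. c i * c j * k i j)"
    and upper: "\<And>c. (\<Sum>i<N. \<Sum>j<N. c i * c j * k i j) \<le> u * (\<Sum>i<N. (c i)\<^sup>2)"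
  shows "l \<le> lambda_min (Matrix.mat N N (\<lambda>(i, j). k i j))"
    and "lambda_max (Matrix.mat N N (\<lambda>(i, j). k i j)) \<le> u"
proof -
  let ?A = "Matrix.mat N N (\<lambda>(i, j). k i j)"
  have fin: "finite (spectrum ?A)" by (rule card_finite_spectrum[of _ N]) simp
  have ne: "spectrum ?A \<noteq> {}" using N sym by (rule symmetric_mat_spectrum_nonempty)
  have bounds: "l \<le> \<mu> \<and> \<mu> \<le> u" if \<mu>: "\<mu> \<in> spectrum ?A" for \<mu>
  proof -
    obtain v where v: "v \<in> carrier_vec N" "v \<noteq> 0\<^sub>v N" "?A *\<^sub>v v = \<mu> \<cdot>\<^sub>v v"
      using \<mu> by (auto simp: spectrum_def eigenvalue_def eigenvector_def)
    let ?c = "vec_index v"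
    have eq: "(\<Sum>j<N. k i j * ?c j) = \<mu> * ?c i" if "i < N" for i
      using arg_cong[OF v(3), of "\<lambda>w. vec_index w i"] that v(1)
      by (simp add: scalar_prod_def atLeast0LessThan)
    have "\<exists>i<N. ?c i \<noteq> 0"
      using v(1,2) by (metis carrier_vecD eq_vecI index_zero_vec)
    then obtain i0 where "i0 < N" "?c i0 \<noteq> 0" by auto
    then have pos: "0 < (\<Sum>i<N. (?c i)\<^sup>2)" by (intro sum_pos2[of _ i0]) auto
    have "(\<Sum>i<N. \<Sum>j<N. ?c i * ?c j * k i j) = (\<Sum>i<N. ?c i * (\<Sum>j<N. k i j * ?c j))"
      by (simp add: sum_distrib_left ac_simps)
    also have "\<dots> = (\<Sum>i<N. ?c i * (\<mu> * ?c i))"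
      by (simp add: eq)
    also have "\<dots> = \<mu> * (\<Sum>i<N. (?c i)\<^sup>2)"
      by (simp add: sum_distrib_left power2_eq_square ac_simps)
    finally show ?thesis using lower[of ?c] upper[of ?c] pos by simp
  qed
  show "l \<le> lambda_min ?A" "lambda_max ?A \<le> u"
    unfolding lambda_min_def lambda_max_def using bounds fin ne by auto
qed

section \<open>The Matern function as a mixture of Gaussians\<close>

definition matern_weight :: "real \<Rightarrow> real \<Rightarrow> real" where
  "matern_weight \<nu> t = exp (\<nu> * t - exp t / 2)"

text \<open>For \<open>0 < \<nu>\<close> this integral also converges at \<open>r = 0\<close>, where
  it supplies the value of the continuous extension of the Matern function up to a constant
  factor.\<close>

definition matern_mixture :: "real \<Rightarrow> real \<Rightarrow> real" where
  "matern_mixture \<nu> r = (\<integral>t. matern_weight \<nu> t * exp (- (exp (- t) / 2 * r\<^sup>2)) \<partial>lborel)"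

lemma matern_weight_pos: "0 < matern_weight \<nu> t"
  by (simp add: matern_weight_def)

lemma matern_weight_measurable [measurable]: "matern_weight \<nu> \<in> borel_measurable borel"
  unfolding matern_weight_def[abs_def] by measurable

section \<open>Integrability of the mixture\<close>

lemma integrable_exp_minus_abs:
  fixes a :: real
  assumes a: "0 < a"
  shows "integrable lborel (\<lambda>t. exp (- (a * \<bar>t\<bar>)))"
proof -
  have half: "integrable lborel (\<lambda>t. indicator {0..} t * exp (- a * t))"
    using nonnegative_absolutely_integrable_1[OF integrable_on_exp_minus_to_infinity[OF a, of 0]]
    by (simp add: set_integrable_def integrable_completion)
  \<comment> \<open>The half-line function plus its mirror image; at \<open>0\<close> both
    indicators are one, so the sum dominates rather than equals the target.\<close>
  have "integrable lborel (\<lambda>t. indicator {0..} t * exp (- a * t) + indicator {0..} (- t) * exp (- a * (- t)))"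
    using half lborel_integrable_real_affine[OF half, of "-1" 0] by simp
  then show ?thesis
    by (rule Bochner_Integration.integrable_bound) (auto simp: indicator_def abs_if)
qed

text \<open>The linear term gives decay as \<open>t\<close> tends to minus infinity and the
  exponential term gives it at plus infinity; together they allow a bound by a multiple of
  \<open>exp (- (\<nu> * \<bar>t\<bar>))\<close>.\<close>

lemma integrable_exp_linear_minus_exp:
  fixes \<nu> a :: real
  assumes \<nu>: "0 < \<nu>" and a: "0 < a"
  shows "integrable lborel (\<lambda>t. exp (\<nu> * t - a * exp t))"
proof (rule Bochner_Integration.integrable_bound)
  show "integrable lborel (\<lambda>t. exp (2 * \<nu>\<^sup>2 / a) * exp (- (\<nu> * \<bar>t\<bar>)))"
    using integrable_exp_minus_abs[OF \<nu>] by simp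
  show "AE t in lborel. norm (exp (\<nu> * t - a * exp t)) \<le> norm (exp (2 * \<nu>\<^sup>2 / a) * exp (- (\<nu> * \<bar>t\<bar>)))"
  proof (intro AE_I2)
    fix t :: real
    have "\<nu> * t - a * exp t \<le> 2 * \<nu>\<^sup>2 / a - \<nu> * \<bar>t\<bar>"
    proof (cases "0 \<le> t")
      case True
      \<comment> \<open>Completing the square explains the constant
        \<open>2 * \<nu>\<^sup>2 / a\<close>; the quadratic term is then swallowed by
        \<open>a * exp t\<close>.\<close>
      have "2 * (\<nu> * t) \<le> 2 * \<nu>\<^sup>2 / a + a * (t\<^sup>2 / 2)"
        using zero_le_power2[of "2 * \<nu> - a * t"] a
        by (simp add: field_simps power2_eq_square)
      also have "a * (t\<^sup>2 / 2) \<le> a * exp t"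
        using exp_lower_Taylor_quadratic[OF True] True a by (intro mult_left_mono) auto
      finally show ?thesis using True by simp
    next
      case False
      have "0 \<le> 2 * \<nu>\<^sup>2 / a" "0 \<le> a * exp t" using a by simp_all
      then show ?thesis using False by simp
    qed
    then show "norm (exp (\<nu> * t - a * exp t)) \<le> norm (exp (2 * \<nu>\<^sup>2 / a) * exp (- (\<nu> * \<bar>t\<bar>)))"
      by (simp flip: exp_add)
  qed
qed simp

lemma matern_mixture_integrable:
  assumes "0 < \<nu>"
  shows "integrable lborel (\<lambda>t. matern_weight \<nu> t * exp (- (exp (- t) / 2 * r\<^sup>2)))"
proof (rule Bochner_Integration.integrable_bound)
  show "integrable lborel (matern_weight \<nu>)"
    using integrable_exp_linear_minus_exp[OF assms, of "1 / 2"] by (simp add: matern_weight_def[abs_def])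
  show "AE t in lborel. norm (matern_weight \<nu> t * exp (- (exp (- t) / 2 * r\<^sup>2))) \<le> norm (matern_weight \<nu> t)"
    by (intro AE_I2) (auto simp: abs_mult intro!: mult_left_le)
qed measurable

section \<open>From the Bessel function to the mixture\<close>

text \<open>\<open>cosh (\<nu> * t)\<close> is the mean of two exponentials; reflecting the second
  one turns the half-line integral into half of an integral over the whole line, which can then be
  translated.\<close>

lemma bessel_K_eq_integral:
  assumes "integrable lborel (\<lambda>t. exp (\<nu> * t - r * cosh t))"
  shows "bessel_K \<nu> r = (\<integral>t. exp (\<nu> * t - r * cosh t) \<partial>lborel) / 2"
proof -
  define g where "g t = exp (\<nu> * t - r * cosh t)" for t :: real
  let ?p = "indicator {0..} :: real \<Rightarrow> real"
  have g: "integrable lborel g" using assms by (simp add: g_def[abs_def])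
  then have [measurable]: "g \<in> borel_measurable lborel" by (rule borel_measurable_integrable)
  have int: "integrable lborel (\<lambda>t. ?p t * g t)" "integrable lborel (\<lambda>t. ?p (- t) * g t)"
    by (rule Bochner_Integration.integrable_bound[OF g]; simp add: indicator_def)+
  have int': "integrable lborel (\<lambda>t. ?p t * g (- t))"
    using lborel_integrable_real_affine[OF int(2), of "-1" 0] by simp
  have "bessel_K \<nu> r = (\<integral>t. (?p t * g t + ?p t * g (- t)) / 2 \<partial>lborel)"
    unfolding bessel_K_def set_lebesgue_integral_def
  proof (intro Bochner_Integration.integral_cong refl)
    fix t :: real
    have "g t = exp (- r * cosh t) * exp (\<nu> * t)" "g (- t) = exp (- r * cosh t) * exp (- (\<nu> * t))"
      by (simp_all add: g_def flip: exp_add)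
    then have "exp (- r * cosh t) * cosh (\<nu> * t) = (g t + g (- t)) / 2"
      by (simp add: cosh_field_def distrib_left)
    then show "?p t *\<^sub>R (exp (- r * cosh t) * cosh (\<nu> * t)) = (?p t * g t + ?p t * g (- t)) / 2"
      by (cases "0 \<le> t") simp_all
  qed
  also have "\<dots> = ((\<integral>t. ?p t * g t \<partial>lborel) + (\<integral>t. ?p t * g (- t) \<partial>lborel)) / 2"
    using int int' by simp
  also have "(\<integral>t. ?p t * g (- t) \<partial>lborel) = (\<integral>t. ?p (- t) * g t \<partial>lborel)"
    by (subst lborel_integral_real_affine[of "-1" _ 0]) simp_all
  also have "(\<integral>t. ?p t * g t \<partial>lborel) + \<dots> = (\<integral>t. ?p t * g t + ?p (- t) * g t \<partial>lborel)"
    using int by simp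
  also have "\<dots> = (\<integral>t. g t \<partial>lborel)"
  proof (rule integral_cong_AE)
    \<comment> \<open>The two closed half-lines overlap only in the null set
      \<open>{0}\<close>.\<close>
    show "AE t in lborel. ?p t * g t + ?p (- t) * g t = g t"
      using AE_lborel_singleton[of 0] by eventually_elim (auto simp: indicator_def)
  qed measurable
  finally show ?thesis by (simp add: g_def)
qed

text \<open>Under the translation by \<open>ln r\<close>, the factor \<open>exp (\<nu> * t)\<close>
  yields \<open>r powr (- \<nu>)\<close>, which cancels the prefactor, and \<open>r * cosh t\<close>
  splits into the exponents of the weight and of the Gaussian.\<close>

lemma powr_bessel_K_eq_mixture:
  assumes \<nu>: "0 < \<nu>" and r: "0 < r"
  shows "r powr \<nu> * bessel_K \<nu> r = matern_mixture \<nu> r / 2"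
proof -
  let ?g = "\<lambda>t. exp (\<nu> * t - r * cosh t)"
  have cosh: "r * cosh (t - ln r) = exp t / 2 + exp (- t) / 2 * r\<^sup>2" for t
    using r by (simp add: cosh_field_def exp_diff exp_minus field_simps power2_eq_square)
  have shift: "r powr \<nu> * ?g (- ln r + 1 * t) = matern_weight \<nu> t * exp (- (exp (- t) / 2 * r\<^sup>2))" for t
    using r cosh[of t] by (simp add: matern_weight_def powr_def algebra_simps flip: exp_add)
  have "integrable lborel (\<lambda>t. r powr \<nu> * ?g (- ln r + 1 * t))"
    unfolding shift by (rule matern_mixture_integrable[OF \<nu>])
  \<comment> \<open>Integrability of the Bessel integrand is read off backwards from that of the
    mixture.\<close>
  then have "integrable lborel (\<lambda>t. ?g (- ln r + 1 * t))" using r by simp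
  then have int: "integrable lborel ?g"
    using lborel_integrable_real_affine_iff[of 1 ?g "- ln r"] by simp
  have "r powr \<nu> * (\<integral>t. ?g t \<partial>lborel) = (\<integral>t. r powr \<nu> * ?g (- ln r + 1 * t) \<partial>lborel)"
    by (subst lborel_integral_real_affine[of 1 _ "- ln r"]) simp_all
  then show ?thesis
    unfolding bessel_K_eq_integral[OF int] shift by (simp add: matern_mixture_def)
qed

text \<open>Dominated convergence, with the weight itself as dominating function because the
  Gaussian factor never exceeds one. This identifies the limit that defines
  \<open>matern_phi\<close> at \<open>0\<close>.\<close>

lemma matern_mixture_tendsto:
  assumes \<nu>: "0 < \<nu>"
  shows "(matern_mixture \<nu> \<longlongrightarrow> matern_mixture \<nu> 0) (at_right 0)"
proof (rule tendsto_at_right_sequentially[of 0 1])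
  fix S :: "nat \<Rightarrow> real" assume "S \<longlonglongrightarrow> 0"
  then show "(\<lambda>n. matern_mixture \<nu> (S n)) \<longlonglongrightarrow> matern_mixture \<nu> 0"
    unfolding matern_mixture_def
  proof (intro integral_dominated_convergence[where w = "matern_weight \<nu>"])
    show "integrable lborel (matern_weight \<nu>)"
      using matern_mixture_integrable[OF \<nu>, of 0] by simp
    show "AE t in lborel. norm (matern_weight \<nu> t * exp (- (exp (- t) / 2 * (S n)\<^sup>2))) \<le> matern_weight \<nu> t" for n
      by (intro AE_I2) (auto simp: abs_mult matern_weight_pos less_imp_le intro!: mult_left_le)
    show "AE t in lborel. (\<lambda>n. matern_weight \<nu> t * exp (- (exp (- t) / 2 * (S n)\<^sup>2))) \<longlonglongrightarrow>
        matern_weight \<nu> t * exp (- (exp (- t) / 2 * 0\<^sup>2))"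
      by (intro AE_I2 tendsto_intros \<open>S \<longlonglongrightarrow> 0\<close>)
  qed auto
qed simp

lemma matern_phi_eq_mixture:
  assumes \<theta>: "real d / 2 < \<theta>"
  shows "\<exists>c>0. \<forall>r\<ge>0. matern_phi d \<theta> r = c * matern_mixture (\<theta> - real d / 2) r"
proof -
  define \<nu> where "\<nu> = \<theta> - real d / 2"
  have \<nu>: "0 < \<nu>" using \<theta> by (simp add: \<nu>_def)
  \<comment> \<open>The last factor \<open>1 / 2\<close> comes from the whole-line form of the
    Bessel integral.\<close>
  define c where "c = 2 powr (1 - \<nu>) / Gamma \<nu> / 2"
  have exponents: "1 - \<theta> + real d / 2 = 1 - \<nu>" "\<theta> - real d / 2 = \<nu>"
    by (simp_all add: \<nu>_def)
  have pos: "matern_phi_pos d \<theta> r = c * matern_mixture \<nu> r" if "0 < r" for r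
    unfolding matern_phi_pos_def exponents mult.assoc powr_bessel_K_eq_mixture[OF \<nu> that]
    by (simp add: c_def)
  have "((\<lambda>r. c * matern_mixture \<nu> r) \<longlongrightarrow> c * matern_mixture \<nu> 0) (at_right 0)"
    by (intro tendsto_intros matern_mixture_tendsto \<nu>)
  moreover have "\<forall>\<^sub>F r in at_right 0. c * matern_mixture \<nu> r = matern_phi_pos d \<theta> r"
    by (simp add: eventually_at_filter pos)
  ultimately have "(matern_phi_pos d \<theta> \<longlongrightarrow> c * matern_mixture \<nu> 0) (at_right 0)"
    by (rule Lim_transform_eventually)
  then have "Lim (at_right 0) (matern_phi_pos d \<theta>) = c * matern_mixture \<nu> 0"
    by (intro tendsto_Lim) auto
  then have "matern_phi d \<theta> r = c * matern_mixture \<nu> r" if "0 \<le> r" for r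
    using that pos[of r] by (simp add: matern_phi_def)
  moreover have "0 < c" using Gamma_real_pos[OF \<nu>] by (simp add: c_def)
  ultimately show ?thesis by (auto simp: \<nu>_def)
qed

lemma matern_mixture_nonneg: "0 \<le> matern_mixture \<nu> r"
  unfolding matern_mixture_def using matern_weight_pos[of \<nu>]
  by (intro Bochner_Integration.integral_nonneg) (simp add: less_imp_le)

text \<open>Half of the exponent \<open>exp t / 2\<close> in the weight is combined with the
  Gaussian exponent to give the decay in \<open>r\<close>; the remaining \<open>exp t / 4\<close>
  keeps the integral over \<open>t\<close> finite.\<close>

lemma matern_mixture_le_exp:
  assumes \<nu>: "0 < \<nu>"
  shows "\<exists>C\<ge>0. \<forall>r. matern_mixture \<nu> r \<le> C * exp (- (r / 2))"
proof (intro exI conjI allI)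
  let ?w = "\<lambda>t. exp (\<nu> * t - 1 / 4 * exp t)"
  show "0 \<le> (\<integral>t. ?w t \<partial>lborel)" by simp
  fix r :: real
  have "matern_mixture \<nu> r \<le> (\<integral>t. ?w t * exp (- (r / 2)) \<partial>lborel)"
    unfolding matern_mixture_def
  proof (rule integral_mono)
    show "integrable lborel (\<lambda>t. matern_weight \<nu> t * exp (- (exp (- t) / 2 * r\<^sup>2)))"
      by (rule matern_mixture_integrable[OF \<nu>])
    show "integrable lborel (\<lambda>t. ?w t * exp (- (r / 2)))"
      using integrable_exp_linear_minus_exp[OF \<nu>, of "1 / 4"] by simp
    fix t :: real
    have "0 \<le> exp (- t) * (exp t - r)\<^sup>2" by simp
    also have "\<dots> = exp t - 2 * r + exp (- t) * r\<^sup>2"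
      by (simp add: power2_diff algebra_simps power2_eq_square exp_minus)
    finally have "r / 2 \<le> 1 / 4 * exp t + exp (- t) * r\<^sup>2 / 4" by simp
    moreover have "0 \<le> exp (- t) * r\<^sup>2" by simp
    ultimately have "r / 2 \<le> 1 / 4 * exp t + exp (- t) / 2 * r\<^sup>2" by linarith
    then show "matern_weight \<nu> t * exp (- (exp (- t) / 2 * r\<^sup>2)) \<le> ?w t * exp (- (r / 2))"
      by (simp add: matern_weight_def flip: exp_add)
  qed
  then show "matern_mixture \<nu> r \<le> (\<integral>t. ?w t \<partial>lborel) * exp (- (r / 2))" by simp
qed

section \<open>Bounds for the kernel matrix\<close>

lemma dist_divideR:
  fixes x y :: "'a::real_normed_vector"
  assumes "0 < b"
  shows "dist (x /\<^sub>R b) (y /\<^sub>R b) = dist x y / b"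
proof -
  have "x /\<^sub>R b - y /\<^sub>R b = (x - y) /\<^sub>R b" by (rule scaleR_diff_right[symmetric])
  then show ?thesis using assms by (simp add: dist_norm divide_inverse)
qed

lemma separated_divideR:
  fixes x :: "'i \<Rightarrow> 'a::real_normed_vector"
  assumes "0 < b" and "pairwise (\<lambda>i j. s \<le> dist (x i) (x j)) I"
  shows "pairwise (\<lambda>i j. s / b \<le> dist (x i /\<^sub>R b) (x j /\<^sub>R b)) I"
  using assms by (auto simp: pairwise_def dist_divideR divide_right_mono)

text \<open>Quantifies diagonal dominance: dividing by \<open>s\<close> makes the points
  1-separated, so one threshold \<open>\<kappa>\<close>, depending only on the dimension, keeps all
  off-diagonal row sums below \<open>1 / 2\<close>.\<close>

lemma gaussian_form_ge_half:
  "\<exists>\<kappa>>0. \<forall>(N::nat) (x :: nat \<Rightarrow> 'a::euclidean_space) s a c.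
    0 < s \<and> pairwise (\<lambda>i j. s \<le> dist (x i) (x j)) {..<N} \<and> \<kappa> \<le> a * s\<^sup>2 \<longrightarrow>
    (\<Sum>i<N. (c i)\<^sup>2) / 2 \<le> (\<Sum>i<N. \<Sum>j<N. c i * c j * exp (- (a * (dist (x i) (x j))\<^sup>2)))"
proof -
  obtain S where S: "0 < S"
    and bound: "\<And>(I :: nat set) (x :: nat \<Rightarrow> 'a) a.
      finite I \<Longrightarrow> pairwise (\<lambda>i j. 1 \<le> dist (x i) (x j)) I \<Longrightarrow> (\<Sum>i\<in>I. exp (- dist a (x i))) \<le> S"
    using separated_exp_sum_bounded[of 1, where 'a = 'a] by auto
  \<comment> \<open>Large enough that \<open>exp (1 - \<kappa>) * S\<close> is at most
    \<open>1 / 2\<close>, and at least one, as the estimate of the entries requires.\<close>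
  define \<kappa> where "\<kappa> = 1 + \<bar>ln (2 * S)\<bar>"
  have "exp (1 - \<kappa>) \<le> exp (- ln (2 * S))" by (simp add: \<kappa>_def)
  also have "\<dots> = 1 / (2 * S)" using S by (simp add: exp_minus inverse_eq_divide)
  finally have \<kappa>: "exp (1 - \<kappa>) * S \<le> 1 / 2" using S by (simp add: field_simps)
  show ?thesis
  proof (intro exI[of _ \<kappa>] conjI allI impI)
    show "0 < \<kappa>" by (simp add: \<kappa>_def add_pos_nonneg)
    fix N :: nat and x :: "nat \<Rightarrow> 'a" and s a :: real and c :: "nat \<Rightarrow> real"
    assume "0 < s \<and> pairwise (\<lambda>i j. s \<le> dist (x i) (x j)) {..<N} \<and> \<kappa> \<le> a * s\<^sup>2"
    then have s: "0 < s" and sep: "pairwise (\<lambda>i j. s \<le> dist (x i) (x j)) {..<N}" and a: "\<kappa> \<le> a * s\<^sup>2"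
      by auto
    define k where "k i j = (if i = j then 0 else exp (- (a * (dist (x i) (x j))\<^sup>2)))" for i j
    have "\<bar>\<Sum>i<N. \<Sum>j<N. c i * c j * k i j\<bar> \<le> 1 / 2 * (\<Sum>i<N. (c i)\<^sup>2)"
    proof (rule abs_quadratic_form_le)
      show "k i j = k j i" for i j by (simp add: k_def dist_commute)
      fix i assume i: "i \<in> {..<N}"
      have "(\<Sum>j<N. \<bar>k i j\<bar>) \<le> (\<Sum>j<N. exp (1 - \<kappa>) * exp (- dist (x i /\<^sub>R s) (x j /\<^sub>R s)))"
      proof (rule sum_mono)
        fix j assume j: "j \<in> {..<N}"
        show "\<bar>k i j\<bar> \<le> exp (1 - \<kappa>) * exp (- dist (x i /\<^sub>R s) (x j /\<^sub>R s))"
        proof (cases "i = j")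
          case False
          define u where "u = dist (x i /\<^sub>R s) (x j /\<^sub>R s)"
          have u_eq: "dist (x i) (x j) = s * u" using s by (simp add: u_def dist_divideR)
          have "s \<le> s * u" using sep i j False by (auto simp: pairwise_def simp flip: u_eq)
          then have u: "1 \<le> u" using s by simp
          \<comment> \<open>This is \<open>(\<kappa> - 1) * (u - 1) \<ge> 0\<close>. It separates
            the small factor \<open>exp (1 - \<kappa>)\<close> from the summable
            \<open>exp (- u)\<close>.\<close>
          have "\<kappa> - 1 + u \<le> \<kappa> * u"
            using mult_nonneg_nonneg[of "\<kappa> - 1" "u - 1"] u by (simp add: \<kappa>_def algebra_simps)
          also have "\<dots> \<le> \<kappa> * u\<^sup>2"
            using u \<open>0 < \<kappa>\<close> by (intro mult_left_mono) (auto simp: power2_eq_square)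
          also have "\<dots> \<le> (a * s\<^sup>2) * u\<^sup>2" using a by (intro mult_right_mono) auto
          also have "\<dots> = a * (dist (x i) (x j))\<^sup>2" by (simp add: u_eq power_mult_distrib)
          finally show ?thesis using False by (simp add: k_def flip: u_def exp_add)
        qed (simp add: k_def)
      qed
      also have "\<dots> = exp (1 - \<kappa>) * (\<Sum>j<N. exp (- dist (x i /\<^sub>R s) (x j /\<^sub>R s)))"
        by (simp add: sum_distrib_left)
      also have "\<dots> \<le> exp (1 - \<kappa>) * S"
        using separated_divideR[OF s sep] s by (intro mult_left_mono bound) auto
      finally show "(\<Sum>j<N. \<bar>k i j\<bar>) \<le> 1 / 2" using \<kappa> by linarith
    qed simp
    \<comment> \<open>The Gaussian matrix is the identity plus \<open>k\<close>, and
      \<open>k\<close> costs at most half of the identity.\<close>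
    moreover have "(\<Sum>i<N. \<Sum>j<N. c i * c j * exp (- (a * (dist (x i) (x j))\<^sup>2))) =
      (\<Sum>i<N. \<Sum>j<N. c i * c j * (if i = j then 1 else 0) + c i * c j * k i j)"
      by (intro sum.cong refl) (simp add: k_def)
    ultimately show "(\<Sum>i<N. (c i)\<^sup>2) / 2 \<le> (\<Sum>i<N. \<Sum>j<N. c i * c j * exp (- (a * (dist (x i) (x j))\<^sup>2)))"
      by (simp add: sum.distrib sum_delta_prod)
  qed
qed

text \<open>Only \<open>t\<close> in \<open>{T - 1..T}\<close> is counted, where the Gaussian form
  is at least half the sum of squares; elsewhere the integrand is nonnegative. The condition
  \<open>s \<le> 2\<close> bounds \<open>exp T\<close>, so \<open>C\<close> can be chosen
  independently of \<open>s\<close>.\<close>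

lemma matern_form_lower:
  assumes \<nu>: "0 < \<nu>"
  shows "\<exists>C>0. \<forall>(N::nat) (x :: nat \<Rightarrow> 'a::euclidean_space) s c.
    0 < s \<and> s \<le> 2 \<and> pairwise (\<lambda>i j. s \<le> dist (x i) (x j)) {..<N} \<longrightarrow>
    C * s powr (2 * \<nu>) * (\<Sum>i<N. (c i)\<^sup>2) \<le>
      (\<Sum>i<N. \<Sum>j<N. c i * c j * matern_mixture \<nu> (dist (x i) (x j)))"
proof -
  obtain \<kappa> where \<kappa>: "0 < \<kappa>"
    and half: "\<And>(N::nat) (x :: nat \<Rightarrow> 'a::euclidean_space) s a c.
      0 < s \<Longrightarrow> pairwise (\<lambda>i j. s \<le> dist (x i) (x j)) {..<N} \<Longrightarrow> \<kappa> \<le> a * s\<^sup>2 \<Longrightarrow>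
      (\<Sum>i<N. (c i)\<^sup>2) / 2 \<le> (\<Sum>i<N. \<Sum>j<N. c i * c j * exp (- (a * (dist (x i) (x j))\<^sup>2)))"
    using gaussian_form_ge_half[where 'a = 'a] by blast
  define C where "C = exp (- \<nu>) * (2 * \<kappa>) powr (- \<nu>) * exp (- (1 / \<kappa>)) / 2"
  show ?thesis
  proof (intro exI[of _ C] conjI allI impI)
    show "0 < C" using \<kappa> by (simp add: C_def)
    fix N :: nat and x :: "nat \<Rightarrow> 'a" and s :: real and c :: "nat \<Rightarrow> real"
    assume "0 < s \<and> s \<le> 2 \<and> pairwise (\<lambda>i j. s \<le> dist (x i) (x j)) {..<N}"
    then have s: "0 < s" "s \<le> 2" and sep: "pairwise (\<lambda>i j. s \<le> dist (x i) (x j)) {..<N}"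
      by auto
    define q where "q = (\<Sum>i<N. (c i)\<^sup>2)"
    \<comment> \<open>The largest \<open>t\<close> allowed by the threshold:
      \<open>exp (- T) / 2 * s\<^sup>2 = \<kappa>\<close>.\<close>
    define T where "T = ln (s\<^sup>2 / (2 * \<kappa>))"
    \<comment> \<open>A lower bound for the weight on \<open>{T - 1..T}\<close>: the increasing term
      is taken at the left end, the decreasing one at the right end.\<close>
    define m where "m = exp (\<nu> * (T - 1) - exp T / 2)"
    have expT: "exp T = s\<^sup>2 / (2 * \<kappa>)" using s \<kappa> by (simp add: T_def)
    have q: "0 \<le> q" unfolding q_def by (simp add: sum_nonneg)
    have "C * s powr (2 * \<nu>) \<le> m / 2"
    proof -
      have "exp (\<nu> * T) = (s\<^sup>2 / (2 * \<kappa>)) powr \<nu>"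
        using s \<kappa> by (simp add: powr_def T_def)
      also have "\<dots> = s powr (2 * \<nu>) * (2 * \<kappa>) powr (- \<nu>)"
        using s \<kappa> powr_powr[of s 2 \<nu>] by (simp add: powr_divide powr_minus_divide)
      finally have nuT: "exp (\<nu> * T) = s powr (2 * \<nu>) * (2 * \<kappa>) powr (- \<nu>)" .
      have "m = exp (\<nu> * T + (- \<nu> + - (exp T / 2)))" by (simp add: m_def algebra_simps)
      also have "\<dots> = exp (\<nu> * T) * exp (- \<nu>) * exp (- (exp T / 2))"
        by (simp only: exp_add mult.assoc)
      finally have m: "m = s powr (2 * \<nu>) * (2 * \<kappa>) powr (- \<nu>) * exp (- \<nu>) * exp (- (exp T / 2))"
        unfolding nuT .
      have "s\<^sup>2 \<le> 2\<^sup>2" using s by (intro power_mono) auto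
      then have "exp T / 2 \<le> 1 / \<kappa>" unfolding expT using \<kappa> by (simp add: field_simps)
      then have "exp (- (1 / \<kappa>)) \<le> exp (- (exp T / 2))" by simp
      then have "s powr (2 * \<nu>) * (2 * \<kappa>) powr (- \<nu>) * exp (- \<nu>) * exp (- (1 / \<kappa>)) \<le> m"
        unfolding m by (intro mult_left_mono) auto
      then show ?thesis by (simp add: C_def ac_simps)
    qed
    then have "C * s powr (2 * \<nu>) * q \<le> m / 2 * q" using q by (rule mult_right_mono)
    \<comment> \<open>The interval has length one, so the constant is its own integral.\<close>
    also have "m / 2 * q = (\<integral>t. indicator {T - 1..T} t * (m * q / 2) \<partial>lborel)"
      by simp
    also have "\<dots> \<le> (\<integral>t. (\<Sum>i<N. \<Sum>j<N. c i * c j *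
        (matern_weight \<nu> t * exp (- (exp (- t) / 2 * (dist (x i) (x j))\<^sup>2)))) \<partial>lborel)"
    proof (rule integral_mono)
      show "integrable lborel (\<lambda>t. indicator {T - 1..T} t * (m * q / 2))"
        by (intro integrable_mult_left integrable_real_indicator) auto
      show "integrable lborel (\<lambda>t. \<Sum>i<N. \<Sum>j<N. c i * c j *
        (matern_weight \<nu> t * exp (- (exp (- t) / 2 * (dist (x i) (x j))\<^sup>2))))"
        by (intro Bochner_Integration.integrable_sum integrable_mult_right matern_mixture_integrable \<nu>)
      fix t :: real
      let ?Q = "\<Sum>i<N. \<Sum>j<N. c i * c j * exp (- (exp (- t) / 2 * (dist (x i) (x j))\<^sup>2))"
      have "indicator {T - 1..T} t * (m * q / 2) \<le> matern_weight \<nu> t * ?Q"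
      proof (cases "t \<in> {T - 1..T}")
        case True
        then have "exp t \<le> s\<^sup>2 / (2 * \<kappa>)" by (simp flip: expT)
        then have "\<kappa> \<le> exp (- t) / 2 * s\<^sup>2" using \<kappa> by (simp add: exp_minus field_simps)
        then have "q / 2 \<le> ?Q" unfolding q_def by (intro half[OF s(1) sep])
        moreover have "\<nu> * (T - 1) - exp T / 2 \<le> \<nu> * t - exp t / 2"
          using True \<nu> by (intro diff_mono mult_left_mono divide_right_mono) auto
        then have "m \<le> matern_weight \<nu> t" unfolding m_def matern_weight_def by simp
        ultimately have "m * (q / 2) \<le> matern_weight \<nu> t * ?Q"
          using q by (intro mult_mono) (auto simp: matern_weight_pos less_imp_le)
        then show ?thesis using True by simp
      next
        case False
        then show ?thesis
          using mult_nonneg_nonneg[OF less_imp_le[OF matern_weight_pos[of \<nu> t]]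
              gaussian_nonneg_definite[of "exp (- t) / 2" c x "{..<N}"]]
          by simp
      qed
      then show "indicator {T - 1..T} t * (m * q / 2) \<le> (\<Sum>i<N. \<Sum>j<N. c i * c j *
          (matern_weight \<nu> t * exp (- (exp (- t) / 2 * (dist (x i) (x j))\<^sup>2))))"
        by (simp add: sum_distrib_left ac_simps)
    qed
    also have "\<dots> = (\<Sum>i<N. \<Sum>j<N. c i * c j * matern_mixture \<nu> (dist (x i) (x j)))"
      by (simp add: matern_mixture_def matern_mixture_integrable[OF \<nu>] Bochner_Integration.integral_sum
          del: times_divide_eq_left)
    finally show "C * s powr (2 * \<nu>) * (\<Sum>i<N. (c i)\<^sup>2) \<le>
      (\<Sum>i<N. \<Sum>j<N. c i * c j * matern_mixture \<nu> (dist (x i) (x j)))"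
      by (simp add: q_def)
  qed
qed

text \<open>The decay \<open>exp (- (r / 2))\<close> is brought to unit rate by halving all points,
  which halves their separation. Here \<open>U\<close> may depend on \<open>s\<close>, unlike the
  constant of the lower bound.\<close>

lemma matern_form_upper:
  assumes \<nu>: "0 < \<nu>" and s: "0 < s"
  shows "\<exists>U>0. \<forall>(N::nat) (x :: nat \<Rightarrow> 'a::euclidean_space) c.
    pairwise (\<lambda>i j. s \<le> dist (x i) (x j)) {..<N} \<longrightarrow>
    (\<Sum>i<N. \<Sum>j<N. c i * c j * matern_mixture \<nu> (dist (x i) (x j))) \<le> U * (\<Sum>i<N. (c i)\<^sup>2)"
proof -
  obtain C where C: "0 \<le> C" "\<And>r. matern_mixture \<nu> r \<le> C * exp (- (r / 2))"
    using matern_mixture_le_exp[OF \<nu>] by auto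
  obtain S where S: "0 < S"
    and bound: "\<And>(I :: nat set) (x :: nat \<Rightarrow> 'a) a.
      finite I \<Longrightarrow> pairwise (\<lambda>i j. s / 2 \<le> dist (x i) (x j)) I \<Longrightarrow> (\<Sum>i\<in>I. exp (- dist a (x i))) \<le> S"
    using separated_exp_sum_bounded[of "s / 2", where 'a = 'a] s by auto
  show ?thesis
  proof (intro exI[of _ "C * S + 1"] conjI allI impI)
    show "0 < C * S + 1" using C(1) S by (simp add: add_nonneg_pos)
    fix N :: nat and x :: "nat \<Rightarrow> 'a" and c :: "nat \<Rightarrow> real"
    assume sep: "pairwise (\<lambda>i j. s \<le> dist (x i) (x j)) {..<N}"
    have "\<bar>\<Sum>i<N. \<Sum>j<N. c i * c j * matern_mixture \<nu> (dist (x i) (x j))\<bar> \<le>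
      (C * S + 1) * (\<Sum>i<N. (c i)\<^sup>2)"
    proof (rule abs_quadratic_form_le)
      show "matern_mixture \<nu> (dist (x i) (x j)) = matern_mixture \<nu> (dist (x j) (x i))" for i j
        by (simp add: dist_commute)
      fix i
      have "(\<Sum>j<N. \<bar>matern_mixture \<nu> (dist (x i) (x j))\<bar>) \<le>
        (\<Sum>j<N. C * exp (- dist (x i /\<^sub>R 2) (x j /\<^sub>R 2)))"
        using C(2) by (intro sum_mono, subst dist_divideR) (simp_all add: matern_mixture_nonneg)
      also have "\<dots> = C * (\<Sum>j<N. exp (- dist (x i /\<^sub>R 2) (x j /\<^sub>R 2)))"
        by (simp add: sum_distrib_left)
      also have "\<dots> \<le> C * S"
        using separated_divideR[OF _ sep, of 2] C(1) by (intro mult_left_mono bound) auto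
      finally show "(\<Sum>j<N. \<bar>matern_mixture \<nu> (dist (x i) (x j))\<bar>) \<le> C * S + 1" by simp
    qed simp
    then show "(\<Sum>i<N. \<Sum>j<N. c i * c j * matern_mixture \<nu> (dist (x i) (x j))) \<le>
      (C * S + 1) * (\<Sum>i<N. (c i)\<^sup>2)"
      by simp
  qed
qed

section \<open>The separation radius and the final estimate\<close>

lemma finite_pairwise_dists:
  assumes "finite X"
  shows "finite {dist x y | x y. x \<in> X \<and> y \<in> X \<and> x \<noteq> y}"
proof (rule finite_subset)
  show "{dist x y | x y. x \<in> X \<and> y \<in> X \<and> x \<noteq> y} \<subseteq> (\<lambda>(x, y). dist x y) ` (X \<times> X)"
    by auto
qed (use assms in simp)

lemma separation_radius_le:
  assumes "finite X" "x \<in> X" "y \<in> X" "x \<noteq> y"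
  shows "2 * separation_radius X \<le> dist x y"
  using finite_pairwise_dists[OF assms(1)] assms(2-)
  unfolding separation_radius_def by (auto intro!: Min_le)

lemma separation_radius_pos:
  assumes "finite X" "x \<in> X" "y \<in> X" "x \<noteq> y"
  shows "0 < separation_radius X"
proof -
  have "Min {dist x y | x y. x \<in> X \<and> y \<in> X \<and> x \<noteq> y} \<in> {dist x y | x y. x \<in> X \<and> y \<in> X \<and> x \<noteq> y}"
    using finite_pairwise_dists[OF assms(1)] assms(2-) by (intro Min_in) auto
  then show ?thesis unfolding separation_radius_def by auto
qed

theorem theorem3p1:
  fixes \<theta> :: real and \<Phi> :: "real ^ 'n \<Rightarrow> real"
  assumes "\<theta> > real CARD('n) / 2"
    and "\<Phi> = matern_kernel \<theta>"
  shows "\<exists>C>0. \<forall>\<eta>>1. \<forall>c_qu>0. \<exists>C'>0.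
    \<forall>(\<Omega> :: (real ^ 'n) set) (N :: nat) (x :: nat \<Rightarrow> real ^ 'n) \<delta> K.
      open \<Omega> \<and> connected \<Omega> \<and> bounded \<Omega> \<and>
      N \<ge> 2 \<and> inj_on x {..<N} \<and> x ` {..<N} \<subseteq> \<Omega> \<and>
      quasi_uniform c_qu (x ` {..<N}) \<Omega> \<and>
      \<delta> = \<eta> * fill_distance (x ` {..<N}) \<Omega> \<and>
      K = kernel_matrix (rescaled_kernel \<delta> \<Phi>) N x
      \<longrightarrow>
      lambda_min K \<ge> C * (\<eta> * c_qu) powr (real CARD('n) - 2 * \<theta>) * \<delta> powr (- real CARD('n)) \<and>
      lambda_max K \<le> C' * \<delta> powr (- real CARD('n))"
proof -
  define \<nu> where "\<nu> = \<theta> - real CARD('n) / 2"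
  have \<nu>: "0 < \<nu>" and exponent: "real CARD('n) - 2 * \<theta> = - (2 * \<nu>)"
    using assms(1) by (simp_all add: \<nu>_def)
  obtain c0 where c0: "0 < c0"
    and phi: "\<And>r. 0 \<le> r \<Longrightarrow> matern_phi CARD('n) \<theta> r = c0 * matern_mixture \<nu> r"
    using matern_phi_eq_mixture[OF assms(1)] unfolding \<nu>_def by blast
  obtain L where L: "0 < L"
    and lower: "\<And>(N::nat) (x :: nat \<Rightarrow> real ^ 'n) s c.
      0 < s \<Longrightarrow> s \<le> 2 \<Longrightarrow> pairwise (\<lambda>i j. s \<le> dist (x i) (x j)) {..<N} \<Longrightarrow>
      L * s powr (2 * \<nu>) * (\<Sum>i<N. (c i)\<^sup>2) \<le>
        (\<Sum>i<N. \<Sum>j<N. c i * c j * matern_mixture \<nu> (dist (x i) (x j)))"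
    using matern_form_lower[OF \<nu>, where 'a = "real ^ 'n"] by blast
  \<comment> \<open>This constant is fixed before \<open>\<eta>\<close> and \<open>c_qu\<close>. The
    power of \<open>2\<close> is what \<open>s powr (2 * \<nu>)\<close> leaves once the power of
    \<open>\<eta> * c_qu\<close> is split off.\<close>
  show ?thesis
  proof (rule exI[of _ "c0 * L * 2 powr (2 * \<nu>)"], intro conjI allI impI)
    show "0 < c0 * L * 2 powr (2 * \<nu>)" using c0 L by simp
    fix \<eta> c_qu :: real assume \<eta>: "1 < \<eta>" and c_qu: "0 < c_qu"
    \<comment> \<open>A lower bound for the separation of the rescaled sites: distances are at least
      \<open>2 * h / c_qu\<close>, and \<open>\<delta> = \<eta> * h\<close>, so \<open>h\<close>
      cancels.\<close>
    define s where "s = 2 / (\<eta> * c_qu)"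
    have s: "0 < s" using \<eta> c_qu by (simp add: s_def)
    obtain U where U: "0 < U"
      and upper: "\<And>(N::nat) (x :: nat \<Rightarrow> real ^ 'n) c.
        pairwise (\<lambda>i j. s \<le> dist (x i) (x j)) {..<N} \<Longrightarrow>
        (\<Sum>i<N. \<Sum>j<N. c i * c j * matern_mixture \<nu> (dist (x i) (x j))) \<le> U * (\<Sum>i<N. (c i)\<^sup>2)"
      using matern_form_upper[OF \<nu> s, where 'a = "real ^ 'n"] by blast
    show "\<exists>C'>0. \<forall>(\<Omega> :: (real ^ 'n) set) (N :: nat) (x :: nat \<Rightarrow> real ^ 'n) \<delta> K.
      open \<Omega> \<and> connected \<Omega> \<and> bounded \<Omega> \<and>
      N \<ge> 2 \<and> inj_on x {..<N} \<and> x ` {..<N} \<subseteq> \<Omega> \<and>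
      quasi_uniform c_qu (x ` {..<N}) \<Omega> \<and>
      \<delta> = \<eta> * fill_distance (x ` {..<N}) \<Omega> \<and>
      K = kernel_matrix (rescaled_kernel \<delta> \<Phi>) N x
      \<longrightarrow>
      lambda_min K \<ge> c0 * L * 2 powr (2 * \<nu>) * (\<eta> * c_qu) powr (real CARD('n) - 2 * \<theta>) * \<delta> powr (- real CARD('n)) \<and>
      lambda_max K \<le> C' * \<delta> powr (- real CARD('n))"
    proof (intro exI[of _ "c0 * U"] conjI[of "0 < c0 * U"] allI impI, goal_cases)
      case 1
      show ?case using c0 U by simp
    next
      case (2 \<Omega> N x \<delta> K)
      let ?X = "x ` {..<N}"
      define h where "h = fill_distance ?X \<Omega>"
      define y where "y i = x i /\<^sub>R \<delta>" for i
      have N: "2 \<le> N" and inj: "inj_on x {..<N}"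
        and qu: "separation_radius ?X \<le> h" "h \<le> c_qu * separation_radius ?X"
        and \<delta>_eq: "\<delta> = \<eta> * h"
        and K: "K = kernel_matrix (rescaled_kernel \<delta> \<Phi>) N x"
        using 2 by (simp_all add: quasi_uniform_def h_def)
      have "x 0 \<noteq> x 1" using inj N by (auto dest: inj_onD)
      then have q: "0 < separation_radius ?X"
        using N by (intro separation_radius_pos[of _ "x 0" "x 1"]) auto
      then have h: "0 < h" using qu by simp
      then have \<delta>: "0 < \<delta>" using \<eta> by (simp add: \<delta>_eq)
      \<comment> \<open>Both halves of quasi-uniformity and a positive separation radius force
        \<open>1 \<le> c_qu\<close>, which yields \<open>s \<le> 2\<close>.\<close>
      have "1 * separation_radius ?X \<le> c_qu * separation_radius ?X" using qu by simp
      then have "1 \<le> c_qu" using q by (simp only: mult_le_cancel_right_pos)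
      then have "1 * 1 \<le> \<eta> * c_qu" using \<eta> by (intro mult_mono) auto
      then have s2: "s \<le> 2" by (simp add: s_def divide_le_eq)
      have "pairwise (\<lambda>i j. s * \<delta> \<le> dist (x i) (x j)) {..<N}"
        unfolding pairwise_def
      proof (intro ballI impI)
        fix i j assume ij: "i \<in> {..<N}" "j \<in> {..<N}" "i \<noteq> j"
        then have "x i \<noteq> x j" using inj by (auto dest: inj_onD)
        then have "2 * separation_radius ?X \<le> dist (x i) (x j)"
          using ij by (intro separation_radius_le) auto
        moreover have "s * \<delta> = 2 * (h / c_qu)" using \<eta> by (simp add: s_def \<delta>_eq)
        moreover have "h / c_qu \<le> separation_radius ?X"
          using qu c_qu by (simp add: divide_le_eq mult.commute)
        ultimately show "s * \<delta> \<le> dist (x i) (x j)" by simp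
      qed
      then have sep: "pairwise (\<lambda>i j. s \<le> dist (y i) (y j)) {..<N}"
        using separated_divideR[OF \<delta>, of "s * \<delta>" x "{..<N}"] \<delta> by (simp add: y_def)
      \<comment> \<open>Collects the Matern normalisation and the scaling factor, so that the matrix
        is \<open>p\<close> times the mixture matrix of the sites \<open>y\<close>.\<close>
      define p where "p = c0 * \<delta> powr (- real CARD('n))"
      have p: "0 \<le> p" using c0 by (simp add: p_def)
      define k where "k i j = p * matern_mixture \<nu> (dist (y i) (y j))" for i j
      have "rescaled_kernel \<delta> \<Phi> (x i - x j) = k i j" for i j
      proof -
        have "norm ((x i - x j) /\<^sub>R \<delta>) = dist (y i) (y j)"
          by (simp add: y_def dist_norm scaleR_diff_right)
        then show ?thesis
          using \<delta> by (simp add: rescaled_kernel_def assms(2) matern_kernel_def phi k_def p_def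
            powr_minus_divide powr_realpow)
      qed
      then have K_eq: "K = Matrix.mat N N (\<lambda>(i, j). k i j)"
        by (simp add: K kernel_matrix_def)
      have form: "(\<Sum>i<N. \<Sum>j<N. c i * c j * k i j) =
        p * (\<Sum>i<N. \<Sum>j<N. c i * c j * matern_mixture \<nu> (dist (y i) (y j)))" for c
        by (simp add: k_def sum_distrib_left ac_simps)
      have sym: "k i j = k j i" for i j by (simp add: k_def dist_commute)
      have l: "p * (L * s powr (2 * \<nu>)) * (\<Sum>i<N. (c i)\<^sup>2) \<le> (\<Sum>i<N. \<Sum>j<N. c i * c j * k i j)" for c
        unfolding form mult.assoc[of p] by (intro mult_left_mono lower s s2 sep p)
      have u: "(\<Sum>i<N. \<Sum>j<N. c i * c j * k i j) \<le> p * U * (\<Sum>i<N. (c i)\<^sup>2)" for c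
        unfolding form mult.assoc[of p] by (intro mult_left_mono upper sep p)
      have "s powr (2 * \<nu>) = 2 powr (2 * \<nu>) * (\<eta> * c_qu) powr (real CARD('n) - 2 * \<theta>)"
        using \<eta> c_qu by (simp add: s_def exponent powr_divide powr_minus_divide)
      then have lower_eq: "c0 * L * 2 powr (2 * \<nu>) * (\<eta> * c_qu) powr (real CARD('n) - 2 * \<theta>) * \<delta> powr (- real CARD('n)) =
        p * (L * s powr (2 * \<nu>))"
        by (simp add: p_def ac_simps)
      have upper_eq: "c0 * U * \<delta> powr (- real CARD('n)) = p * U" by (simp add: p_def ac_simps)
      show ?case
        unfolding K_eq lower_eq upper_eq using symmetric_mat_spectrum_bounds[OF _ sym l u] N by simp
    qed
  qed
qed

end
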